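(* Let $\varepsilon\in(0,\tfrac12)$ and let $A\subseteq[1-\varepsilon,1]$. Let $I_G$ and $I_{NM}$ be the residual implications associated with $T_G$ and $T_{NM}$, respectively. Then $I_G(x,y)=I_{NM}(x,y)$ for all $(x,y)\in A\times A$. Consequently, if $\mathcal U$ is an ultrafilter on $[0,1]$ with $A\in\mathcal U$, then $I_G\sim_{\mathcal U}I_{NM}$.
   Context: $T_G(x,y)=\min\{x,y\}$, and $T_{NM}(x,y)=\min\{x,y\}$ if $x+y>1$ and $0$ if $x+y\le 1$, for $x,y\in[0,1]$. The residual implication of a $t$-norm $T$ on $[0,1]$ is $I_T:[0,1]^2\to[0,1]$, $I_T(x,y)=\sup\{z\in[0,1]:T(x,z)\le y\}$; $I_G=I_{T_G}$ and $I_{NM}=I_{T_{NM}}$. For an ultrafilter $\mathcal U$ on $[0,1]$ and binary operations $S,T:[0,1]^2\to[0,1]$, write $S\sim_{\mathcal U}T$ if there is $B\in\mathcal U$ with $S(x,y)=T(x,y)$ for all $(x,y)\in B\times B$. *)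

theory Defs
  imports Complex_Main
begin

text \<open>
  Operations on \<open>[0,1]\<close> are represented by functions on all reals; only their values
  at arguments in \<open>{0..1}\<close> carry meaning.
\<close>

definition T_G :: "real \<Rightarrow> real \<Rightarrow> real" where
  "T_G x y = min x y"

definition T_NM :: "real \<Rightarrow> real \<Rightarrow> real" where
  "T_NM x y = (if x + y > 1 then min x y else 0)"

text \<open>
  \<open>Sup\<close> on \<^typ>\<open>real\<close> is unspecified on empty sets. For \<open>T\<close> a t-norm and \<open>x\<close>, \<open>y\<close> in \<open>{0..1}\<close>
  the set below contains \<open>0\<close> (as \<open>T x 0 = 0\<close>) and is bounded by \<open>1\<close>, so this is the
  genuine supremum.
\<close>

definition residual_impl :: "(real \<Rightarrow> real \<Rightarrow> real) \<Rightarrow> real \<Rightarrow> real \<Rightarrow> real" where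
  "residual_impl T x y = Sup {z \<in> {0..1}. T x z \<le> y}"

definition I_G :: "real \<Rightarrow> real \<Rightarrow> real" where
  "I_G = residual_impl T_G"

definition I_NM :: "real \<Rightarrow> real \<Rightarrow> real" where
  "I_NM = residual_impl T_NM"

text \<open>
  A filter on a set \<open>X\<close> is encoded as a filter on the ambient type that contains \<open>X\<close>
  (\<open>F \<le> principal X\<close>); for \<open>B \<subseteq> X\<close>, membership of \<open>B\<close> in the filter is
  \<open>\<forall>\<^sub>F x in F. x \<in> B\<close>.
\<close>

definition ultrafilter_on :: "'a set \<Rightarrow> 'a filter \<Rightarrow> bool" where
  "ultrafilter_on X F \<longleftrightarrow>
     F \<noteq> bot \<and> F \<le> principal X \<and>
     (\<forall>B\<subseteq>X. (\<forall>\<^sub>F x in F. x \<in> B) \<or> (\<forall>\<^sub>F x in F. x \<in> X - B))"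

definition ultra_equiv ::
  "real filter \<Rightarrow> (real \<Rightarrow> real \<Rightarrow> real) \<Rightarrow> (real \<Rightarrow> real \<Rightarrow> real) \<Rightarrow> bool" where
  "ultra_equiv U S T \<longleftrightarrow>
     (\<exists>B\<subseteq>{0..1}. (\<forall>\<^sub>F x in U. x \<in> B) \<and> (\<forall>(x, y) \<in> B \<times> B. S x y = T x y))"

end

theory Submission
  imports Defs
begin

text \<open>
  The two t-norms differ only at points \<open>(x, z)\<close> with \<open>x + z \<le> 1\<close>. If \<open>0 \<le> y\<close> and \<open>1 - x \<le> y\<close>, such a \<open>z\<close>
  satisfies \<open>z \<le> 1 - x \<le> y\<close>, so both \<open>min x z\<close> and \<open>0\<close> are at most \<open>y\<close>: passing from one t-norm
  to the other leaves the sublevel set \<open>{z. T x z \<le> y}\<close> unchanged, and with it the supremum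
  (\<open>I_G_eq_I_NM\<close>). Since \<open>\<epsilon> < 1/2\<close>, any two points of \<open>A\<close> exceed \<open>1/2\<close> and thus have sum greater
  than \<open>1\<close>; and \<open>A\<close> itself witnesses equivalence modulo each ultrafilter containing it.
\<close>

lemma T_G_le_iff_T_NM_le:
  assumes "0 \<le> y" and "1 \<le> x + y"
  shows "T_G x z \<le> y \<longleftrightarrow> T_NM x z \<le> y"
  using assms by (auto simp: T_G_def T_NM_def)

lemma I_G_eq_I_NM:
  assumes "0 \<le> y" and "1 \<le> x + y"
  shows "I_G x y = I_NM x y"
  by (simp add: I_G_def I_NM_def residual_impl_def T_G_le_iff_T_NM_le[OF assms])

theorem proposition8p3:
  fixes \<epsilon> :: real and A :: "real set"
  assumes "\<epsilon> \<in> {0<..<1/2}"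
    and "A \<subseteq> {1 - \<epsilon>..1}"
  shows "(\<forall>(x, y) \<in> A \<times> A. I_G x y = I_NM x y) \<and>
    (\<forall>U. ultrafilter_on {0..1} U \<longrightarrow> (\<forall>\<^sub>F x in U. x \<in> A) \<longrightarrow> ultra_equiv U I_G I_NM)"
proof -
  have upper_half: "1/2 < x \<and> x \<le> 1" if "x \<in> A" for x
    using assms that by force
  have agree: "\<forall>(x, y) \<in> A \<times> A. I_G x y = I_NM x y"
  proof clarify
    fix x y
    assume "x \<in> A" "y \<in> A"
    then show "I_G x y = I_NM x y"
      using upper_half[of x] upper_half[of y] by (intro I_G_eq_I_NM) auto
  qed
  moreover have "A \<subseteq> {0..1}"
    using upper_half by force
  ultimately show ?thesis
    unfolding ultra_equiv_def by blast
qed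

end
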